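(* Let $t_0>0$, $\tau>0$, $a\in C([0,\infty),\mathbb{R})$, $b,c\in C([0,\infty),[0,\infty))$ with $b\not\equiv 0$ or $c\not\equiv 0$; let $t_0<t_1<t_2<\cdots$ be real numbers with $\lim_{i\to\infty}t_i=\infty$, and let $b_i\in(-\infty,1)$ for $i=1,2,\dots$. Put $l=\min\{\tau,1\}$. If at least one of the following two conditions holds: $$\liminf_{t\to\infty}\int_{t-l}^{t}\Big(\prod_{s-\tau<t_j\le s}(1-b_j)\Big)b(s)\exp\Big(\int_{s-\tau}^{s}a(u)\,du\Big)ds>\frac1e,$$ $$\liminf_{n\to\infty,\ n\in\mathbb{N}}\int_{n+1-l}^{n+1}\Big(\prod_{n-1<t_j\le s}(1-b_j)\Big)c(s)\exp\Big(\int_{n-1}^{s}a(u)\,du\Big)ds>\frac1e,$$ then every solution of the impulsive equation $$x'(t)+a(t)x(t)+b(t)x(t-\tau)+c(t)x([t-1])=0,\ t\ne t_i,\ t\ge t_0;\qquad \Delta x(t_i)=b_ix(t_i),\ i=1,2,\dots$$ is oscillatory.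
   Context: $[\cdot]$ is the greatest integer function. $\Delta x(t_i)=x(t_i^+)-x(t_i^-)$, where $x(t_i^\pm)$ are the one-sided limits. An empty product equals $1$. A solution of the impulsive equation is a function $x:\{-1\}\cup[-\tau,\infty)\to\mathbb{R}$ such that: - $x$ is continuous on $[-\tau,\infty)$ except possibly at the points $t_i$, $i\ge1$; - $x$ is right continuous and has a left-hand limit at each $t_i$; - for every $t\ge t_0$ that is neither one of the $t_i$ ($i\ge 1$) nor an integer, $x$ is differentiable at $t$ (from the right if $t=t_0$) and satisfies the differential equation. At the points $t_i$ and the integers $t\ge t_0$, one-sided derivatives exist (the left derivative at $t_i$ being computed with the value $x(t_i^-)$); - $\Delta x(t_i)=b_ix(t_i)$ for all $i\ge1$. Since $x$ is right continuous, this means $x(t_i^-)=(1-b_i)x(t_i)$. A function is oscillatory if it is neither eventually positive (positive for all sufficiently large $t$) nor eventually negative (negative for all sufficiently large $t$). *)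

theory Defs
  imports "HOL-Analysis.Analysis"
begin

definition oscillatory :: "(real \<Rightarrow> real) \<Rightarrow> bool" where
  "oscillatory x \<longleftrightarrow>
     \<not> (\<forall>\<^sub>F r in at_top. x r > 0) \<and> \<not> (\<forall>\<^sub>F r in at_top. x r < 0)"

text \<open>
  The operator \<open>Lim\<close> returns a meaningful value only if the limit exists; the solution
  predicate below requires this wherever the following two notions are used.
\<close>

definition jump :: "(real \<Rightarrow> real) \<Rightarrow> real \<Rightarrow> real" where
  "jump x r = Lim (at_right r) x - Lim (at_left r) x"

text \<open>
  The left derivative is taken with the left-hand limit in place of the value of the function,
  which matters at the jumps.
\<close>

definition has_left_deriv :: "(real \<Rightarrow> real) \<Rightarrow> real \<Rightarrow> bool" where
  "has_left_deriv x r \<longleftrightarrow>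
     (\<exists>D. (x(r := Lim (at_left r) x) has_real_derivative D) (at_left r))"

definition has_right_deriv :: "(real \<Rightarrow> real) \<Rightarrow> real \<Rightarrow> bool" where
  "has_right_deriv x r \<longleftrightarrow> (\<exists>D. (x has_real_derivative D) (at_right r))"

text \<open>
  A solution is a function on \<open>{-1} \<union> [-\<tau>, \<infinity>)\<close>, represented by a total function whose
  values elsewhere play no role. The initial time is \<open>t 0\<close>; impulses of size \<open>\<beta> i\<close> occur at
  \<open>t i\<close> for \<open>i \<ge> 1\<close>, and \<open>\<beta> 0\<close> is irrelevant. At the initial time all derivatives
  are from the right.
\<close>

definition impulsive_solution ::
  "real \<Rightarrow> (real \<Rightarrow> real) \<Rightarrow> (real \<Rightarrow> real) \<Rightarrow> (real \<Rightarrow> real) \<Rightarrow>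
   (nat \<Rightarrow> real) \<Rightarrow> (nat \<Rightarrow> real) \<Rightarrow> (real \<Rightarrow> real) \<Rightarrow> bool" where
  "impulsive_solution \<tau> a b c t \<beta> x \<longleftrightarrow>
     (\<forall>r\<ge>-\<tau>. r \<notin> t ` {1..} \<longrightarrow> continuous (at r within {-\<tau>..}) x) \<and>
     (\<forall>i\<ge>1. continuous (at_right (t i)) x \<and> (\<exists>L. (x \<longlongrightarrow> L) (at_left (t i)))) \<and>
     (\<forall>r\<ge>t 0. r \<notin> t ` {1..} \<and> r \<notin> \<int> \<longrightarrow>
        (\<exists>D. (x has_real_derivative D) (at r within {t 0..}) \<and>
             D + a r * x r + b r * x (r - \<tau>) + c r * x (of_int \<lfloor>r - 1\<rfloor>) = 0)) \<and>
     (\<forall>r\<ge>t 0. r \<in> t ` {1..} \<or> r \<in> \<int> \<longrightarrow>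
        has_right_deriv x r \<and> (r > t 0 \<longrightarrow> has_left_deriv x r)) \<and>
     (\<forall>i\<ge>1. jump x (t i) = \<beta> i * x (t i))"

end

theory Submission
  imports Defs
begin

text \<open>
  Multiplying a solution \<open>x\<close> by the jump factors \<open>1 - \<beta> j\<close> with \<open>t j \<le> s\<close> and by the
  exponential of the integral of \<open>a\<close> gives a continuous function \<open>y\<close> of the same sign with
  \<open>y' s = - B s * y (s - \<tau>) - C s * y \<lfloor>s - 1\<rfloor>\<close>, where \<open>B\<close> and \<open>C\<close> are the
  integrands of the two conditions. If \<open>y\<close> is eventually positive, it is eventually decreasing.
  Under the first condition the ratio \<open>y (s - l) / y s\<close> is eventually at least every power of
  \<open>e k > 1\<close>, where \<open>k\<close> is a lower bound of the integrals; but splitting an interval of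
  length \<open>l\<close> into two parts of integral at least \<open>k / 2\<close> gives points with ratio at most
  \<open>4 / k\<^sup>2\<close>. Under the second condition \<open>y (n + 1) \<le> y n - k * y (n - 1)\<close> at the
  integers, which is impossible for a positive sequence since \<open>k > 1 / 4\<close>.
\<close>

section \<open>Increments and monotonicity with finitely many exceptional points\<close>

text \<open>The set \<open>S\<close> absorbs impulses and integers, where no derivative is
  available. Only \<open>B\<close> has to be integrable: for the gauge integral the fundamental
  theorem itself yields integrability of the derivative of \<open>g\<close>.\<close>

lemma increment_ge:
  fixes g B :: "real \<Rightarrow> real"
  assumes uv: "u \<le> v" and fin: "finite S" and cont: "continuous_on {u..v} g"
    and der: "\<And>s. s \<in> {u<..<v} - S \<Longrightarrow> \<exists>D. (g has_real_derivative D) (at s) \<and> K * B s \<le> D"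
    and int: "B integrable_on {u..v}"
  shows "K * integral {u..v} B \<le> g v - g u"
proof -
  obtain g' where g': "\<And>s. s \<in> {u<..<v} - S \<Longrightarrow> (g has_real_derivative g' s) (at s) \<and> K * B s \<le> g' s"
    using der by metis
  have 1: "(g' has_integral (g v - g u)) {u..v}"
    using uv fin cont g'
    by (intro fundamental_theorem_of_calculus_interior_strong[where S = S])
       (auto simp: has_real_derivative_iff_has_vector_derivative)
  \<comment> \<open>At the exceptional points the derivative is replaced by the lower bound, so that
    the comparison holds at every point; a finite change leaves the integral alone.\<close>
  define h where "h s = (if s \<in> {u<..<v} - S then g' s else K * B s)" for s
  have 2: "(h has_integral (g v - g u)) {u..v}"
    by (rule has_integral_spike_finite[OF _ _ 1, where S = "insert u (insert v S)"])
       (use fin in \<open>auto simp: h_def\<close>)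
  have 3: "((\<lambda>s. K * B s) has_integral (K * integral {u..v} B)) {u..v}"
    using has_integral_mult_right int integrable_integral by blast
  show ?thesis
    by (rule has_integral_le[OF 3 2]) (use g' in \<open>auto simp: h_def\<close>)
qed

lemma antimono_if_deriv_nonpos:
  fixes y :: "real \<Rightarrow> real"
  assumes fin: "\<And>u v. finite (S \<inter> {u..v})" and cont: "continuous_on {T..} y"
    and der: "\<And>r. r > T \<Longrightarrow> r \<notin> S \<Longrightarrow> \<exists>D\<le>0. (y has_real_derivative D) (at r)"
    and "T \<le> u" "u \<le> v"
  shows "y v \<le> y u"
proof -
  have "1 * integral {u..v} (\<lambda>_. 0) \<le> - y v - - y u"
  proof (rule increment_ge[where S = "S \<inter> {u..v}"])
    show "continuous_on {u..v} (\<lambda>r. - y r)"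
      by (intro continuous_intros continuous_on_subset[OF cont]) (use assms(4) in auto)
    show "\<exists>D. ((\<lambda>r. - y r) has_real_derivative D) (at s) \<and> 1 * 0 \<le> D"
      if "s \<in> {u<..<v} - S \<inter> {u..v}" for s
    proof -
      have "s > T" "s \<notin> S" using that assms(4) by auto
      with der obtain D where "D \<le> 0" "(y has_real_derivative D) (at s)" by blast
      then show ?thesis by (intro exI[of _ "- D"]) (auto intro: DERIV_minus)
    qed
  qed (use assms in auto)
  then show ?thesis by simp
qed

section \<open>Nonexistence of positive decreasing solutions\<close>

text \<open>Two estimates of \<open>y (r - l) / y r\<close> collide: induction makes it at least
  \<open>q ^ n\<close>, while halving the integral bounds it at some points independently of
  \<open>n\<close>. The derivative is only bounded above, so that further nonnegative terms can be
  discarded and a longer delay shortened beforehand.\<close>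

lemma no_positive_delay_decay:
  fixes y B :: "real \<Rightarrow> real"
  assumes l: "l > 0" and fin: "\<And>u v. finite (S \<inter> {u..v})"
    and cont: "continuous_on {T..} y" and pos: "\<And>r. r \<ge> T \<Longrightarrow> y r > 0"
    and der: "\<And>r. r > T + l \<Longrightarrow> r \<notin> S \<Longrightarrow>
      \<exists>D. (y has_real_derivative D) (at r) \<and> D \<le> - (B r * y (r - l))"
    and mono: "\<And>u v. T \<le> u \<Longrightarrow> u \<le> v \<Longrightarrow> y v \<le> y u"
    and B: "\<And>r. r \<ge> T \<Longrightarrow> B r \<ge> 0"
    and k: "k > 1 / exp 1"
    and int: "\<And>r. r \<ge> T + l \<Longrightarrow> B integrable_on {r - l..r}"
    and intk: "\<And>r. r \<ge> T + l \<Longrightarrow> integral {r - l..r} B \<ge> k"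
  shows False
proof -
  have k0: "k > 0" using k by (smt (verit) exp_gt_zero divide_pos_pos)
  define q where "q = exp 1 * k"
  have q: "q > 1" using k by (simp add: q_def field_simps)
  \<comment> \<open>Each induction step needs the previous bound on all of the interval from
    \<open>r - l\<close> to \<open>r\<close>, hence the starting point moves by
    \<open>l\<close>.\<close>
  have ratio: "y (r - l) \<ge> q ^ n * y r" if "r \<ge> T + (real n + 1) * l" for n r
    using that
  proof (induction n arbitrary: r)
    case 0
    then show ?case using mono[of "r - l" r] l by simp
  next
    case (Suc n)
    have r: "r \<ge> T + real n * l + 2 * l" using Suc.prems by (simp add: algebra_simps)
    moreover have "real n * l \<ge> 0" using l by simp
    ultimately have rT: "r \<ge> T + 2 * l" by linarith
    \<comment> \<open>The induction hypothesis gives \<open>- y' / y\<close> at least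
      \<open>q ^ n * B\<close>; integrating this turns the ratio \<open>q ^ n\<close> into
      \<open>exp (q ^ n * k)\<close>.\<close>
    have "q ^ n * integral {r - l..r} B \<le> - ln (y r) - - ln (y (r - l))"
    proof (rule increment_ge[where S = "S \<inter> {r - l..r}"])
      show "continuous_on {r - l..r} (\<lambda>r. - ln (y r))"
      proof (intro continuous_intros continuous_on_subset[OF cont] ballI)
        have "T \<le> r - l" using rT l by linarith
        then show "{r - l..r} \<subseteq> {T..}" by auto
        then show "y s \<noteq> 0" if "s \<in> {r - l..r}" for s using pos[of s] that by auto
      qed
      show "\<exists>D. ((\<lambda>r. - ln (y r)) has_real_derivative D) (at s) \<and> q ^ n * B s \<le> D"
        if s: "s \<in> {r - l<..<r} - S \<inter> {r - l..r}" for s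
      proof -
        have sT: "s > T + l" "s \<notin> S" using s rT l by auto
        obtain D where D: "(y has_real_derivative D) (at s)" "D \<le> - (B s * y (s - l))"
          using der[OF sT] by auto
        have ys: "y s > 0" using pos sT l by simp
        have "q ^ n * y s \<le> y (s - l)"
          by (rule Suc.IH) (use s r in \<open>auto simp: algebra_simps\<close>)
        then have "B s * (q ^ n * y s) \<le> B s * y (s - l)"
          by (rule mult_left_mono) (use B sT l in auto)
        with D have "q ^ n * B s * y s \<le> - D" by (simp add: algebra_simps)
        then have "q ^ n * B s \<le> - D / y s" using ys by (simp add: field_simps)
        moreover have "((\<lambda>r. - ln (y r)) has_real_derivative - D / y s) (at s)"
          using D(1) ys by (auto intro!: derivative_eq_intros)
        ultimately show ?thesis by blast
      qed
      show "B integrable_on {r - l..r}" using int rT l by auto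
    qed (use l fin in auto)
    moreover have "q ^ n * k \<le> q ^ n * integral {r - l..r} B"
      using intk[of r] rT l q by (intro mult_left_mono) auto
    ultimately have le: "q ^ n * k + ln (y r) \<le> ln (y (r - l))" by simp
    have p: "y r > 0" "y (r - l) > 0" using pos rT l by auto
    have "exp (q ^ n * k + ln (y r)) \<le> y (r - l)"
      using le p by (metis exp_le_cancel_iff exp_ln)
    then have "exp (q ^ n * k) * y r \<le> y (r - l)" using p by (simp add: exp_add)
    \<comment> \<open>The inequality \<open>exp z\<close> \<ge> \<open>exp 1 * z\<close> at
      \<open>z = q ^ n * k\<close> gains one factor \<open>q\<close>. This is where the constant
      \<open>1 / exp 1\<close> comes from.\<close>
    moreover have "q ^ Suc n \<le> exp (q ^ n * k)"
    proof -
      have "q ^ n * k \<le> exp (q ^ n * k - 1)"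
        using exp_ge_add_one_self[of "q ^ n * k - 1"] by simp
      then show ?thesis by (simp add: exp_diff q_def field_simps)
    qed
    ultimately show ?case using p by (smt (verit) mult_right_mono)
  qed
  \<comment> \<open>Since \<open>y\<close> decreases, \<open>y (s - l)\<close> is at least
    \<open>y (v - l)\<close> for \<open>s\<close> between \<open>u\<close> and \<open>v\<close>, and
    this constant can leave the integral.\<close>
  have drop: "y u - y v \<ge> y (v - l) * integral {u..v} B"
    if uv: "T + l \<le> u" "u \<le> v" "B integrable_on {u..v}" for u v
  proof -
    have "y (v - l) * integral {u..v} B \<le> - y v - - y u"
    proof (rule increment_ge[where S = "S \<inter> {u..v}"])
      show "continuous_on {u..v} (\<lambda>r. - y r)"
        by (intro continuous_intros continuous_on_subset[OF cont]) (use uv l in auto)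
      show "\<exists>D. ((\<lambda>r. - y r) has_real_derivative D) (at s) \<and> y (v - l) * B s \<le> D"
        if s: "s \<in> {u<..<v} - S \<inter> {u..v}" for s
      proof -
        obtain D where D: "(y has_real_derivative D) (at s)" "D \<le> - (B s * y (s - l))"
          using der[of s] s uv by auto
        have "B s * y (v - l) \<le> B s * y (s - l)"
          using s uv l by (intro mult_left_mono mono B) auto
        with D show ?thesis
          by (intro exI[of _ "- D"]) (auto intro: DERIV_minus simp: mult.commute)
      qed
    qed (use fin uv in auto)
    then show ?thesis by simp
  qed
  have bound: "k\<^sup>2 / 4 * q ^ n \<le> 1" for n
  proof -
    \<comment> \<open>The 3 leaves room for \<open>s\<close> and \<open>s - l\<close>, with
      \<open>s\<close> possibly as small as \<open>r - l\<close>, in both \<open>drop\<close> and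
      \<open>ratio\<close>.\<close>
    define r where "r = T + (real n + 3) * l"
    have r: "r = T + real n * l + 3 * l" by (simp add: r_def algebra_simps)
    moreover have "real n * l \<ge> 0" using l by simp
    ultimately have rT: "r \<ge> T + 3 * l" by linarith
    have intr: "B integrable_on {r - l..r}" using int rT l by auto
    have kr: "k \<le> integral {r - l..r} B" using intk rT l by auto
    \<comment> \<open>At this \<open>s\<close> the first part has integral exactly
      \<open>k / 2\<close>, so at least \<open>k / 2\<close> is left for the second. The drops over
      the two parts chain \<open>y (s - l)\<close> to \<open>y (r - l)\<close> and then to
      \<open>y s\<close>.\<close>
    have "\<exists>s\<ge>r - l. s \<le> r \<and> integral {r - l..s} B = k / 2"
      by (rule IVT') (use kr k0 l indefinite_integral_continuous_1[OF intr] in auto)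
    then obtain s where s: "r - l \<le> s" "s \<le> r" "integral {r - l..s} B = k / 2" by blast
    have i1: "B integrable_on {r - l..s}" and i2: "B integrable_on {s..r}"
      by (rule integrable_on_subinterval[OF intr]; use s in auto)+
    have s2: "k / 2 \<le> integral {s..r} B"
      using Henstock_Kurzweil_Integration.integral_combine[OF s(1,2) intr] s(3) kr by simp
    have p: "y s > 0" "y (s - l) > 0" "y (r - l) > 0" "y r > 0" using pos s rT l by auto
    have "y (r - l) - y s \<ge> y (s - l) * integral {r - l..s} B"
      by (rule drop) (use s i1 rT l in auto)
    then have a1: "y (s - l) * (k / 2) \<le> y (r - l)" using s(3) p by simp
    have "y s - y r \<ge> y (r - l) * integral {s..r} B"
      by (rule drop) (use s i2 rT l in auto)
    moreover have "y (r - l) * (k / 2) \<le> y (r - l) * integral {s..r} B"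
      using s2 p by (intro mult_left_mono) auto
    ultimately have a2: "y (r - l) * (k / 2) \<le> y s" using p by linarith
    have "y (s - l) * (k / 2) * (k / 2) \<le> y (r - l) * (k / 2)"
      using a1 k0 by (intro mult_right_mono) auto
    with a2 have "(k / 2) * (k / 2) * y (s - l) \<le> y s" by (simp add: algebra_simps)
    moreover have "q ^ n * y s \<le> y (s - l)"
      by (rule ratio) (use s r rT l in \<open>auto simp: algebra_simps\<close>)
    then have "(k / 2) * (k / 2) * (q ^ n * y s) \<le> (k / 2) * (k / 2) * y (s - l)"
      using k0 by (intro mult_left_mono) auto
    ultimately have "(k\<^sup>2 / 4 * q ^ n) * y s \<le> 1 * y s"
      by (simp add: power2_eq_square algebra_simps)
    then show ?thesis using p mult_le_cancel_right_pos by blast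
  qed
  obtain n where "4 / k\<^sup>2 < q ^ n" using q real_arch_pow by blast
  then have "1 < k\<^sup>2 / 4 * q ^ n" using k0 by (simp add: field_simps)
  with bound[of n] show False by simp
qed

text \<open>The ratio \<open>w (n + 1) / w n\<close> drops by at least \<open>k - 1 / 4\<close> in each step, since
  \<open>1 - k / r \<le> r - (k - 1 / 4)\<close> for \<open>0 < r \<le> 1\<close>.\<close>

lemma no_positive_difference_decay:
  fixes w :: "nat \<Rightarrow> real"
  assumes k: "k > 1 / 4" and pos: "\<And>n. w n > 0"
    and step: "\<And>n. w (Suc (Suc n)) \<le> w (Suc n) - k * w n"
  shows False
proof -
  define \<rho> where "\<rho> n = w (Suc n) / w n" for n
  have \<rho>0: "\<rho> n > 0" for n using pos by (simp add: \<rho>_def)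
  have wle: "w (Suc (Suc n)) \<le> w (Suc n)" for n
    using step[of n] pos[of n] k by (smt (verit) mult_pos_pos divide_pos_pos)
  \<comment> \<open>The bound starts at index 1, because \<open>step\<close> does not compare
    \<open>w 1\<close> with \<open>w 0\<close>.\<close>
  have \<rho>1: "\<rho> (Suc n) \<le> 1" for n using wle pos by (simp add: \<rho>_def)
  have dec: "\<rho> (Suc (Suc n)) \<le> \<rho> (Suc n) - (k - 1 / 4)" for n
  proof -
    let ?r = "\<rho> (Suc n)"
    have "\<rho> (Suc (Suc n)) \<le> 1 - k / ?r"
      using step[of "Suc n"] pos[of "Suc n"] pos[of "Suc (Suc n)"] pos[of n]
      by (simp add: \<rho>_def field_simps)
    moreover have "1 - k / ?r \<le> ?r - (k - 1 / 4)"
    proof -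
      have "?r - ?r\<^sup>2 \<le> 1 / 4"
        using zero_le_power2[of "?r - 1 / 2"] by (simp add: power2_eq_square algebra_simps)
      moreover have "(k - 1 / 4) * ?r \<le> k - 1 / 4"
        using \<rho>1[of n] k mult_left_mono[of ?r 1 "k - 1 / 4"] by simp
      ultimately have "?r + (k - 1 / 4) * ?r \<le> ?r\<^sup>2 + k" by simp
      then show ?thesis using \<rho>0[of "Suc n"] by (simp add: field_simps power2_eq_square)
    qed
    ultimately show ?thesis by simp
  qed
  have lin: "\<rho> (Suc n) \<le> 1 - real n * (k - 1 / 4)" for n
  proof (induction n)
    case (Suc n)
    then show ?case using dec[of n] by (simp add: algebra_simps add_divide_distrib)
  qed (use \<rho>1 in simp)
  obtain n where "1 < real n * (k - 1 / 4)"
    using k reals_Archimedean3[of "k - 1 / 4"] by auto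
  with lin[of n] \<rho>0[of "Suc n"] show False by simp
qed


section \<open>Contradiction for the equation without impulses\<close>

text \<open>Both delayed terms are nonnegative, so \<open>y\<close> decreases and either term may be
  dropped; what remains is the differential inequality or the difference inequality above.
  \<open>C\<close> carries the index \<open>n\<close> because its coefficient depends on the integer
  part of the argument.\<close>

lemma no_positive_delay_solution:
  fixes y B :: "real \<Rightarrow> real" and C :: "nat \<Rightarrow> real \<Rightarrow> real"
  assumes \<tau>: "\<tau> > 0" and l: "l = min \<tau> 1" and T: "T \<ge> 0"
    and fin: "\<And>u v. finite (S \<inter> {u..v})"
    and cont: "continuous_on {T..} y" and pos: "\<And>r. r \<ge> T \<Longrightarrow> y r > 0"
    and der: "\<And>r. r \<ge> T + \<tau> + 1 \<Longrightarrow> r \<notin> S \<Longrightarrow>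
      (y has_real_derivative
        - (B r * y (r - \<tau>) + C (nat \<lfloor>r\<rfloor>) r * y (real (nat \<lfloor>r\<rfloor>) - 1))) (at r)"
    and B: "\<And>r. r \<ge> T \<Longrightarrow> B r \<ge> 0" and C: "\<And>n r. r \<ge> T \<Longrightarrow> C n r \<ge> 0"
    and k: "k > 1 / exp 1"
    and large: "(\<forall>\<^sub>F r in at_top. integral {r - l..r} B > k) \<or>
      (\<forall>\<^sub>F n in sequentially. integral {real n + 1 - l..real n + 1} (C n) > k)"
  shows False
proof -
  have k0: "k > 0" using k by (smt (verit) exp_gt_zero divide_pos_pos)
  \<comment> \<open>From here on both \<open>r - \<tau>\<close> and the integer part of
    \<open>r\<close> minus 1 are at least \<open>T\<close>, where \<open>y\<close> is
    positive.\<close>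
  define T' where "T' = T + \<tau> + 2"
  have B_term: "B r * y (r - \<tau>) \<ge> 0"
    and C_term: "C (nat \<lfloor>r\<rfloor>) r * y (real (nat \<lfloor>r\<rfloor>) - 1) \<ge> 0" if "r \<ge> T'" for r
  proof -
    have "y (r - \<tau>) > 0" using that by (intro pos) (simp add: T'_def)
    moreover have "real (nat \<lfloor>r\<rfloor>) - 1 \<ge> T" using that \<tau> T unfolding T'_def by linarith
    then have "y (real (nat \<lfloor>r\<rfloor>) - 1) > 0" by (rule pos)
    ultimately show "B r * y (r - \<tau>) \<ge> 0"
      "C (nat \<lfloor>r\<rfloor>) r * y (real (nat \<lfloor>r\<rfloor>) - 1) \<ge> 0"
      using B[of r] C[of r] that \<tau> by (simp_all add: T'_def)
  qed
  have mono: "y v \<le> y u" if uv: "T' \<le> u" "u \<le> v" for u v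
  proof (rule antimono_if_deriv_nonpos[where y = y and S = S and T = T' and u = u and v = v])
    show "continuous_on {T'..} y"
      by (rule continuous_on_subset[OF cont]) (use \<tau> in \<open>auto simp: T'_def\<close>)
    show "\<exists>D\<le>0. (y has_real_derivative D) (at r)" if "r > T'" "r \<notin> S" for r
      using der[of r] B_term[of r] C_term[of r] that
      by (intro exI conjI) (auto simp: T'_def)
  qed (use fin uv in auto)
  from large show False
  proof
    assume "\<forall>\<^sub>F r in at_top. integral {r - l..r} B > k"
    then obtain R where R: "\<And>r. r \<ge> R \<Longrightarrow> integral {r - l..r} B > k"
      by (auto simp: eventually_at_top_linorder)
    \<comment> \<open>The extra \<tau> keeps \<open>r - \<tau>\<close> in the range where
      \<open>y\<close> is known to decrease.\<close>
    define T1 where "T1 = max T' R + \<tau>"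
    have T1: "T1 \<ge> T' + \<tau>" "T1 \<ge> R" using \<tau> by (auto simp: T1_def)
    have lpos: "l > 0" "l \<le> \<tau>" using l \<tau> by auto
    show False
    proof (rule no_positive_delay_decay[where l = l and T = T1 and y = y and B = B and S = S and k = k])
      show "continuous_on {T1..} y"
        by (rule continuous_on_subset[OF cont]) (use \<tau> T1 in \<open>auto simp: T'_def\<close>)
      show "y r > 0" if "r \<ge> T1" for r using pos that T1 \<tau> by (simp add: T'_def)
      show "B r \<ge> 0" if "r \<ge> T1" for r using B that T1 \<tau> by (simp add: T'_def)
      show "y v \<le> y u" if "T1 \<le> u" "u \<le> v" for u v using mono that T1 \<tau> by simp
      show "\<exists>D. (y has_real_derivative D) (at r) \<and> D \<le> - (B r * y (r - l))"
        if r: "r > T1 + l" "r \<notin> S" for r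
      proof -
        \<comment> \<open>Monotonicity and \<open>l\<close> \<le> \<tau> allow the delay \<tau> to
          be shortened to \<open>l\<close>.\<close>
        have "B r * y (r - l) \<le> B r * y (r - \<tau>)"
          using r T1 lpos \<tau> by (intro mult_left_mono mono B) (auto simp: T'_def)
        then show ?thesis
          using der[of r] C_term[of r] r T1 lpos \<tau>
          by (intro exI conjI) (auto simp: T'_def)
      qed
      show ik: "integral {r - l..r} B \<ge> k" if "r \<ge> T1 + l" for r
        using R[of r] that T1 lpos by simp
      \<comment> \<open>The integral of a non-integrable function is \<open>0\<close>, so integrability comes for free.\<close>
      show "B integrable_on {r - l..r}" if "r \<ge> T1 + l" for r
        using ik[OF that] k0 not_integrable_integral[of B "{r - l..r}"] by force
    qed (use lpos fin k in auto)
  next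
    assume "\<forall>\<^sub>F n in sequentially. integral {real n + 1 - l..real n + 1} (C n) > k"
    then obtain N0 where N0: "\<And>n. n \<ge> N0 \<Longrightarrow> integral {real n + 1 - l..real n + 1} (C n) > k"
      by (auto simp: eventually_sequentially)
    obtain N1 where N1: "T' \<le> real N1" using real_arch_simple by blast
    define N where "N = max N0 N1"
    show False
    proof (rule no_positive_difference_decay[where k = k and w = "\<lambda>m. y (real (N + m))"])
      have "exp 1 \<le> (4 :: real)" using exp_le by simp
      then have "1 / 4 \<le> 1 / exp (1::real)" by (intro divide_left_mono) auto
      with k show "k > 1 / 4" by linarith
      have NT: "real (N + m) \<ge> T'" for m using N1 by (auto simp: N_def)
      show "y (real (N + m)) > 0" for m
        using NT[of m] \<tau> by (intro pos) (simp add: T'_def)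
      show "y (real (N + Suc (Suc m))) \<le> y (real (N + Suc m)) - k * y (real (N + m))" for m
      proof -
        \<comment> \<open>The middle one of the three consecutive indices.\<close>
        define n where "n = N + Suc m"
        have n: "real n - 1 \<ge> T'" using NT[of m] by (simp add: n_def)
        have ik: "integral {real n + 1 - l..real n + 1} (C n) > k"
          by (rule N0) (simp add: n_def N_def)
        have yn: "y (real n - 1) > 0" using n \<tau> by (intro pos) (simp add: T'_def)
        \<comment> \<open>Between \<open>n\<close> and \<open>n + 1\<close> the piecewise constant
          argument stays at \<open>n - 1\<close>, so its value of \<open>y\<close> is a constant
          factor. The interval of integration lies there because \<open>l\<close> \<le> 1; the rest
          of the unit interval is handled by monotonicity.\<close>
        have "y (real n - 1) * integral {real n + 1 - l..real n + 1} (C n)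
            \<le> - y (real n + 1) - - y (real n + 1 - l)"
        proof (rule increment_ge[where S = "S \<inter> {real n + 1 - l..real n + 1}"])
          show "continuous_on {real n + 1 - l..real n + 1} (\<lambda>r. - y r)"
            by (intro continuous_intros continuous_on_subset[OF cont])
               (use n \<tau> l in \<open>auto simp: T'_def\<close>)
          show "C n integrable_on {real n + 1 - l..real n + 1}"
            using ik k0 not_integrable_integral[of "C n"] by force
          show "\<exists>D. ((\<lambda>r. - y r) has_real_derivative D) (at s) \<and> y (real n - 1) * C n s \<le> D"
            if s: "s \<in> {real n + 1 - l<..<real n + 1} - S \<inter> {real n + 1 - l..real n + 1}" for s
          proof -
            have sn: "real n < s" "s < real n + 1" "s \<notin> S" using s l by auto
            then have fl: "nat \<lfloor>s\<rfloor> = n" by linarith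
            have sT: "s \<ge> T'" using sn n by simp
            then have "s \<ge> T + \<tau> + 1" by (simp add: T'_def)
            from DERIV_minus[OF der[OF this sn(3)]] B_term[OF sT] show ?thesis
              unfolding fl by (intro exI conjI) (auto simp: mult.commute)
          qed
        qed (use fin l \<tau> in auto)
        moreover have "y (real n - 1) * k \<le> y (real n - 1) * integral {real n + 1 - l..real n + 1} (C n)"
          using ik yn by (intro mult_left_mono) auto
        moreover have "y (real n + 1 - l) \<le> y (real n)"
          using n l by (intro mono) auto
        ultimately have "y (real n + 1) \<le> y (real n) - k * y (real n - 1)"
          by (simp add: mult.commute)
        then show ?thesis by (simp add: n_def add_ac)
      qed
    qed
  qed
qed

section \<open>Impulse products and the integrating factor\<close>

text \<open>At \<open>t i\<close> this step function acquires the factor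
  \<open>1 - \<beta> i\<close>, which offsets the jump of a solution there. Divergence of
  \<open>t\<close> makes the index set finite; over an infinite set the product would default to
  1.\<close>

definition impulse_weight :: "(nat \<Rightarrow> real) \<Rightarrow> (nat \<Rightarrow> real) \<Rightarrow> real \<Rightarrow> real" where
  "impulse_weight t \<beta> s = (\<Prod>j | j \<ge> 1 \<and> t j \<le> s. 1 - \<beta> j)"

lemma finite_impulses:
  fixes t :: "nat \<Rightarrow> real"
  assumes "filterlim t at_top sequentially"
  shows "finite {j. t j \<le> r}"
proof -
  obtain N where N: "\<And>j. j \<ge> N \<Longrightarrow> t j > r"
    using assms by (auto simp: filterlim_at_top_dense eventually_sequentially)
  have "{j. t j \<le> r} \<subseteq> {..<N}" using N by (force simp: not_le[symmetric])
  then show ?thesis by (rule finite_subset) simp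
qed

lemma impulse_weight_pos:
  assumes "\<And>i. i \<ge> 1 \<Longrightarrow> \<beta> i < 1"
  shows "impulse_weight t \<beta> s > 0"
  unfolding impulse_weight_def using assms by (intro prod_pos) auto

text \<open>Source of the products over a window in the two conditions: with \<open>u\<close> the
  delayed argument, they are the quotient of the weights at \<open>s\<close> and at
  \<open>u\<close>.\<close>

lemma impulse_weight_split:
  fixes t :: "nat \<Rightarrow> real"
  assumes "filterlim t at_top sequentially" "u \<le> s"
  shows "impulse_weight t \<beta> s =
    impulse_weight t \<beta> u * (\<Prod>j | j \<ge> 1 \<and> u < t j \<and> t j \<le> s. 1 - \<beta> j)"
proof -
  have "{j. j \<ge> 1 \<and> t j \<le> s} = {j. j \<ge> 1 \<and> t j \<le> u} \<union> {j. j \<ge> 1 \<and> u < t j \<and> t j \<le> s}"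
    using assms(2) by auto
  moreover have "finite {j. j \<ge> 1 \<and> t j \<le> u}" "finite {j. j \<ge> 1 \<and> u < t j \<and> t j \<le> s}"
    using finite_impulses[OF assms(1)] by simp_all
  moreover have "{j. j \<ge> 1 \<and> t j \<le> u} \<inter> {j. j \<ge> 1 \<and> u < t j \<and> t j \<le> s} = {}"
    by auto
  ultimately show ?thesis
    unfolding impulse_weight_def by (simp only: prod.union_disjoint)
qed

text \<open>Between consecutive impulses the weight is a constant, which passes through limits and
  derivatives.\<close>

lemma impulse_weight_eq:
  assumes "strict_mono t" "t n \<le> s" "s < t (Suc n)"
  shows "impulse_weight t \<beta> s = (\<Prod>j=1..n. 1 - \<beta> j)"
proof -
  have "t j \<le> s \<longleftrightarrow> j \<le> n" for j
    using assms(2,3) strict_mono_less_eq[OF assms(1), of j n]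
      strict_mono_less_eq[OF assms(1), of "Suc n" j] by linarith
  then show ?thesis by (auto simp: impulse_weight_def intro: prod.cong)
qed

lemma ex_impulse_interval:
  fixes t :: "nat \<Rightarrow> real"
  assumes "filterlim t at_top sequentially" "t 0 \<le> r"
  obtains n where "t n \<le> r" "r < t (Suc n)"
proof -
  obtain m where "r < t m"
    using assms(1) by (auto simp: filterlim_at_top_dense eventually_sequentially)
  with ex_least_nat_less[of "\<lambda>i. r < t i" m] assms(2) that show thesis
    by (meson linorder_not_le order_refl)
qed

lemma exp_integral_deriv:
  fixes a :: "real \<Rightarrow> real"
  assumes "continuous_on {0..} a" "r > 0"
  shows "((\<lambda>s. exp (integral {0..s} a)) has_real_derivative exp (integral {0..r} a) * a r) (at r)"
proof -
  have "continuous_on {0..r + 1} a" by (rule continuous_on_subset[OF assms(1)]) auto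
  from integral_has_real_derivative[OF this, of r] assms(2)
  have "((\<lambda>s. integral {0..s} a) has_real_derivative a r) (at r)"
    using at_within_Icc_at[of 0 r "r + 1"] by simp
  then show ?thesis by (rule DERIV_fun_exp)
qed

lemma exp_integral_split:
  fixes a :: "real \<Rightarrow> real"
  assumes "continuous_on {0..} a" "0 \<le> u" "u \<le> s"
  shows "exp (integral {0..s} a) = exp (integral {0..u} a) * exp (integral {u..s} a)"
proof -
  have "a integrable_on {0..s}"
    by (intro integrable_continuous_real continuous_on_subset[OF assms(1)]) auto
  from Henstock_Kurzweil_Integration.integral_combine[OF assms(2,3) this, symmetric]
  show ?thesis by (simp add: exp_add)
qed

section \<open>Removal of the impulses from the equation\<close>

text \<open>Multiplying by the jump factors removes the discontinuities of the solution; the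
  exponential removes the undelayed term.\<close>

definition transformed ::
  "(real \<Rightarrow> real) \<Rightarrow> (nat \<Rightarrow> real) \<Rightarrow> (nat \<Rightarrow> real) \<Rightarrow> (real \<Rightarrow> real) \<Rightarrow> real \<Rightarrow> real" where
  "transformed a t \<beta> x s = x s * impulse_weight t \<beta> s * exp (integral {0..s} a)"

lemma impulsive_solutionD:
  assumes sol: "impulsive_solution \<tau> a b c t \<beta> x"
  shows impulsive_solution_continuous:
      "r \<ge> - \<tau> \<Longrightarrow> r \<notin> t ` {1..} \<Longrightarrow> continuous (at r within {-\<tau>..}) x"
    and impulsive_solution_right_continuous: "i \<ge> 1 \<Longrightarrow> continuous (at_right (t i)) x"
    and impulsive_solution_left_limit: "i \<ge> 1 \<Longrightarrow> \<exists>L. (x \<longlongrightarrow> L) (at_left (t i))"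
    and impulsive_solution_deriv: "r \<ge> t 0 \<Longrightarrow> r \<notin> t ` {1..} \<Longrightarrow> r \<notin> \<int> \<Longrightarrow>
      \<exists>D. (x has_real_derivative D) (at r within {t 0..}) \<and>
        D + a r * x r + b r * x (r - \<tau>) + c r * x (of_int \<lfloor>r - 1\<rfloor>) = 0"
    and impulsive_solution_jump: "i \<ge> 1 \<Longrightarrow> jump x (t i) = \<beta> i * x (t i)"
proof -
  note sol' = sol[unfolded impulsive_solution_def]
  note rest = conjunct2[OF sol']
  show "r \<ge> - \<tau> \<Longrightarrow> r \<notin> t ` {1..} \<Longrightarrow> continuous (at r within {-\<tau>..}) x"
    by (rule conjunct1[OF sol', rule_format])
  show "i \<ge> 1 \<Longrightarrow> continuous (at_right (t i)) x" "i \<ge> 1 \<Longrightarrow> \<exists>L. (x \<longlongrightarrow> L) (at_left (t i))"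
    using conjunct1[OF rest] by simp_all
  show "\<exists>D. (x has_real_derivative D) (at r within {t 0..}) \<and>
      D + a r * x r + b r * x (r - \<tau>) + c r * x (of_int \<lfloor>r - 1\<rfloor>) = 0"
    if "r \<ge> t 0" "r \<notin> t ` {1..}" "r \<notin> \<int>"
    by (rule conjunct1[OF conjunct2[OF rest], rule_format]) (intro that conjI)+
  show "i \<ge> 1 \<Longrightarrow> jump x (t i) = \<beta> i * x (t i)"
    by (rule conjunct2[OF conjunct2[OF conjunct2[OF rest]], rule_format])
qed

lemma at_within_atLeast_eq_at:
  fixes r :: real
  shows "q < r \<Longrightarrow> at r within {q..} = at r"
  by (rule at_within_interior) simp

text \<open>At an impulse the left limit of \<open>x\<close> is
  \<open>(1 - \<beta> i) * x (t i)\<close>, while the weight to the left lacks exactly the factor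
  \<open>1 - \<beta> i\<close>; the two one-sided limits of the product agree. Elsewhere the weight
  is locally constant.\<close>

lemma isCont_transformed:
  assumes sol: "impulsive_solution \<tau> a b c t \<beta> x"
    and t: "t 0 > 0" "strict_mono t" "filterlim t at_top sequentially"
    and \<tau>: "\<tau> > 0" and a: "continuous_on {0..} a" and r: "r > t 0"
  shows "isCont (transformed a t \<beta> x) r"
proof -
  let ?E = "\<lambda>s. exp (integral {0..s} a)"
  let ?Q = "\<lambda>n. \<Prod>j=1..n. 1 - \<beta> j"
  have E: "isCont ?E r"
    using DERIV_isCont[OF exp_integral_deriv[OF a]] r t(1) by simp
  have y: "transformed a t \<beta> x s = x s * ?Q n * ?E s" if "t n \<le> s" "s < t (Suc n)" for n s
    using impulse_weight_eq[OF t(2) that] by (simp add: transformed_def)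
  show ?thesis
  proof (cases "r \<in> t ` {1..}")
    case False
    obtain n where n: "t n \<le> r" "r < t (Suc n)"
      using ex_impulse_interval[OF t(3), of r] r by auto
    \<comment> \<open>The index 0 is treated apart: \<open>t 0\<close> is the initial time and not
      an impulse.\<close>
    have "t n \<noteq> r" using False r by (cases n) auto
    with n have rn: "r \<in> {t n<..<t (Suc n)}" by auto
    have "continuous (at r within {-\<tau>..}) x"
      using False r t(1) \<tau> by (intro impulsive_solution_continuous[OF sol]) auto
    then have "isCont x r" using at_within_atLeast_eq_at[of "-\<tau>" r] r t(1) \<tau> by simp
    then have "isCont (\<lambda>s. x s * ?Q n * ?E s) r"
      by (rule isCont_mult[OF isCont_mult[OF _ continuous_const] E])
    moreover have "\<forall>\<^sub>F s in nhds r. transformed a t \<beta> x s = x s * ?Q n * ?E s"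
      using eventually_nhds_in_open[OF open_greaterThanLessThan rn]
      by eventually_elim (use y[of n] in auto)
    ultimately show ?thesis by (subst isCont_cong)
  next
    case True
    then obtain i where "i \<ge> 1" "r = t i" by auto
    then obtain m where i: "i = Suc m" by (cases i) auto
    have lt: "t m < r" "r < t (Suc i)"
      unfolding \<open>r = t i\<close> i by (rule strict_monoD[OF t(2)]; simp)+
    have right: "(x \<longlongrightarrow> x r) (at_right r)"
      using impulsive_solution_right_continuous[OF sol \<open>i \<ge> 1\<close>] \<open>r = t i\<close>
      by (simp add: continuous_within)
    obtain L where L: "(x \<longlongrightarrow> L) (at_left r)"
      using impulsive_solution_left_limit[OF sol \<open>i \<ge> 1\<close>] \<open>r = t i\<close> by blast
    have "jump x r = \<beta> i * x r"
      using impulsive_solution_jump[OF sol \<open>i \<ge> 1\<close>] \<open>r = t i\<close> by simp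
    \<comment> \<open>Both one-sided limits exist, so \<open>Lim\<close> returns their true
      values.\<close>
    moreover have "jump x r = x r - L"
      using tendsto_Lim[OF _ right] tendsto_Lim[OF _ L] by (simp add: jump_def)
    ultimately have L_eq: "L = (1 - \<beta> i) * x r" by (simp add: algebra_simps)
    have ER: "(?E \<longlongrightarrow> ?E r) (at_right r)" and EL: "(?E \<longlongrightarrow> ?E r) (at_left r)"
      using E unfolding isCont_def filterlim_at_split by auto
    have yr: "transformed a t \<beta> x r = x r * ?Q i * ?E r"
      using y[of i r] lt \<open>r = t i\<close> by auto
    have "((\<lambda>s. x s * ?Q i * ?E s) \<longlongrightarrow> transformed a t \<beta> x r) (at_right r)"
      unfolding yr by (intro tendsto_intros right ER)
    moreover have "\<forall>\<^sub>F s in at_right r. x s * ?Q i * ?E s = transformed a t \<beta> x s"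
      using eventually_at_right_real[OF lt(2)]
      by eventually_elim (use y[of i] \<open>r = t i\<close> in auto)
    ultimately have R: "(transformed a t \<beta> x \<longlongrightarrow> transformed a t \<beta> x r) (at_right r)"
      by (rule Lim_transform_eventually)
    \<comment> \<open>The factor \<open>1 - \<beta> i\<close> moves from the product up to
      \<open>i\<close> into \<open>L\<close>, leaving the product up to \<open>m\<close>.\<close>
    have "transformed a t \<beta> x r = L * ?Q m * ?E r"
      unfolding yr L_eq i by simp
    then have "((\<lambda>s. x s * ?Q m * ?E s) \<longlongrightarrow> transformed a t \<beta> x r) (at_left r)"
      by (simp only:) (intro tendsto_intros L EL)
    moreover have "\<forall>\<^sub>F s in at_left r. x s * ?Q m * ?E s = transformed a t \<beta> x s"
      using eventually_at_left_real[OF lt(1)]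
      by eventually_elim (use y[of m] \<open>r = t i\<close> i in auto)
    ultimately have "(transformed a t \<beta> x \<longlongrightarrow> transformed a t \<beta> x r) (at_left r)"
      by (rule Lim_transform_eventually)
    from filterlim_split_at[OF this R] show ?thesis by (simp only: isCont_def)
  qed
qed

text \<open>The product rule cancels the term with \<open>a\<close>. Splitting weight and
  exponential at each delayed argument turns the delayed values of \<open>x\<close> into those of
  the transformed function, with the integrands of the two conditions as coefficients. The bounds
  \<tau> and 1 on \<open>r\<close> keep the delayed arguments nonnegative, as the base point 0 of
  the integral requires.\<close>

lemma transformed_deriv:
  assumes sol: "impulsive_solution \<tau> a b c t \<beta> x"
    and t: "t 0 > 0" "strict_mono t" "filterlim t at_top sequentially"
    and \<tau>: "\<tau> > 0" and a: "continuous_on {0..} a"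
    and r: "r > t 0" "r \<ge> \<tau>" "r \<ge> 1" "r \<notin> t ` {1..}" "r \<notin> \<int>"
    and n: "n = nat \<lfloor>r\<rfloor>"
  shows "(transformed a t \<beta> x has_real_derivative
    - ((\<Prod>j | j \<ge> 1 \<and> r - \<tau> < t j \<and> t j \<le> r. 1 - \<beta> j) * b r * exp (integral {r - \<tau>..r} a) *
        transformed a t \<beta> x (r - \<tau>) +
       (\<Prod>j | j \<ge> 1 \<and> real n - 1 < t j \<and> t j \<le> r. 1 - \<beta> j) * c r * exp (integral {real n - 1..r} a) *
        transformed a t \<beta> x (real n - 1))) (at r)"
proof -
  let ?E = "\<lambda>s. exp (integral {0..s} a)"
  let ?W = "impulse_weight t \<beta>"
  have r0: "r > 0" using r(1) t(1) by simp
  obtain m where m: "t m \<le> r" "r < t (Suc m)"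
    using ex_impulse_interval[OF t(3) less_imp_le[OF r(1)]] .
  have "t m \<noteq> r" using r by (cases m) auto
  with m have rm: "r \<in> {t m<..<t (Suc m)}" by auto
  have W: "?W s = (\<Prod>j=1..m. 1 - \<beta> j)" if "s \<in> {t m<..<t (Suc m)}" for s
    using impulse_weight_eq[OF t(2)] that by auto
  obtain D where D: "(x has_real_derivative D) (at r within {t 0..})"
    and eq: "D + a r * x r + b r * x (r - \<tau>) + c r * x (of_int \<lfloor>r - 1\<rfloor>) = 0"
    using impulsive_solution_deriv[OF sol less_imp_le[OF r(1)] r(4,5)] by blast
  have Dr: "(x has_real_derivative D) (at r)"
    using D at_within_atLeast_eq_at[OF r(1)] by simp
  have "\<lfloor>r\<rfloor> \<ge> 1" using r(3) by simp
  then have "real n = of_int \<lfloor>r\<rfloor>" using n by simp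
  with \<open>\<lfloor>r\<rfloor> \<ge> 1\<close> have fl: "of_int \<lfloor>r - 1\<rfloor> = real n - 1" "real n \<ge> 1" "real n \<le> r"
    by simp_all
  have split_\<tau>:
    "?W r = ?W (r - \<tau>) * (\<Prod>j | j \<ge> 1 \<and> r - \<tau> < t j \<and> t j \<le> r. 1 - \<beta> j)"
    "?E r = ?E (r - \<tau>) * exp (integral {r - \<tau>..r} a)"
    using impulse_weight_split[OF t(3), of "r - \<tau>" r \<beta>] exp_integral_split[OF a, of "r - \<tau>" r]
      r(2) \<tau> by linarith+
  have split_n:
    "?W r = ?W (real n - 1) * (\<Prod>j | j \<ge> 1 \<and> real n - 1 < t j \<and> t j \<le> r. 1 - \<beta> j)"
    "?E r = ?E (real n - 1) * exp (integral {real n - 1..r} a)"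
    using impulse_weight_split[OF t(3), of "real n - 1" r \<beta>] exp_integral_split[OF a, of "real n - 1" r]
      fl(2,3) by linarith+
  have "?W r * ?E r * b r * x (r - \<tau>) =
      (\<Prod>j | j \<ge> 1 \<and> r - \<tau> < t j \<and> t j \<le> r. 1 - \<beta> j) * b r * exp (integral {r - \<tau>..r} a) *
        transformed a t \<beta> x (r - \<tau>)" (is "_ = ?Bterm")
    unfolding transformed_def split_\<tau> by (simp only: mult_ac)
  moreover have "?W r * ?E r * c r * x (real n - 1) =
      (\<Prod>j | j \<ge> 1 \<and> real n - 1 < t j \<and> t j \<le> r. 1 - \<beta> j) * c r * exp (integral {real n - 1..r} a) *
        transformed a t \<beta> x (real n - 1)" (is "_ = ?Cterm")
    unfolding transformed_def split_n by (simp only: mult_ac)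
  moreover have "D * ?W r * ?E r + ?E r * a r * (x r * ?W r) =
      - (?W r * ?E r * b r * x (r - \<tau>) + ?W r * ?E r * c r * x (real n - 1))"
    using eq unfolding fl by algebra
  ultimately have eq': "D * ?W r * ?E r + ?E r * a r * (x r * ?W r) = - (?Bterm + ?Cterm)"
    by (simp only:)
  \<comment> \<open>The weight is frozen at \<open>r\<close> for differentiation; it equals this
    constant on the open interval between the neighbouring impulses.\<close>
  have "((\<lambda>s. x s * ?W r * ?E s) has_real_derivative - (?Bterm + ?Cterm)) (at r)"
    by (rule DERIV_cong[OF DERIV_mult[OF DERIV_cmult_right[OF Dr] exp_integral_deriv[OF a r0]] eq'])
  then show ?thesis
    by (rule has_field_derivative_transform_within_open[OF _ _ rm])
       (simp_all only: transformed_def W[OF rm] W open_greaterThanLessThan)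
qed

section \<open>From the lower limits to oscillation\<close>

text \<open>The decay arguments need one fixed \<open>k\<close> beyond the threshold; density
  supplies it strictly between the threshold and the lower limit.\<close>

lemma less_Liminf_real_dense:
  assumes "ereal q < Liminf F (\<lambda>r. ereal (f r))"
  obtains k where "k > q" "\<forall>\<^sub>F r in F. f r > k"
proof -
  obtain k where "ereal q < ereal k" "ereal k < Liminf F (\<lambda>r. ereal (f r))"
    using ereal_dense2[OF assms] by blast
  with less_LiminfD[OF this(2)] that show thesis by simp
qed

theorem theorem3:
  fixes \<tau> l :: real
    and a b c :: "real \<Rightarrow> real"
    and t \<beta> :: "nat \<Rightarrow> real"
  assumes "t 0 > 0" and "\<tau> > 0"
    and "continuous_on {0..} a"
    and "continuous_on {0..} b" and "\<And>s. s \<ge> 0 \<Longrightarrow> b s \<ge> 0"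
    and "continuous_on {0..} c" and "\<And>s. s \<ge> 0 \<Longrightarrow> c s \<ge> 0"
    and "(\<exists>s\<ge>0. b s \<noteq> 0) \<or> (\<exists>s\<ge>0. c s \<noteq> 0)"
    and "strict_mono t" and "filterlim t at_top sequentially"
    and "\<And>i. i \<ge> 1 \<Longrightarrow> \<beta> i < 1"
    and "l = min \<tau> 1"
    and "Liminf at_top (\<lambda>r::real. ereal (integral {r - l..r} (\<lambda>s.
            (\<Prod>j | j \<ge> 1 \<and> s - \<tau> < t j \<and> t j \<le> s. 1 - \<beta> j) * b s *
            exp (integral {s - \<tau>..s} a)))) > ereal (1 / exp 1)
       \<or> liminf (\<lambda>n::nat. ereal (integral {real n + 1 - l..real n + 1} (\<lambda>s.
            (\<Prod>j | j \<ge> 1 \<and> real n - 1 < t j \<and> t j \<le> s. 1 - \<beta> j) * c s *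
            exp (integral {real n - 1..s} a)))) > ereal (1 / exp 1)"
  shows "\<forall>x. impulsive_solution \<tau> a b c t \<beta> x \<longrightarrow> oscillatory x"
proof (intro allI impI)
  fix x assume sol: "impulsive_solution \<tau> a b c t \<beta> x"
  define B where "B s = (\<Prod>j | j \<ge> 1 \<and> s - \<tau> < t j \<and> t j \<le> s. 1 - \<beta> j) * b s *
    exp (integral {s - \<tau>..s} a)" for s
  define C where "C n s = (\<Prod>j | j \<ge> 1 \<and> real n - 1 < t j \<and> t j \<le> s. 1 - \<beta> j) * c s *
    exp (integral {real n - 1..s} a)" for n :: nat and s
  define S where "S = t ` {1..} \<union> \<int>"
  have fin: "finite (S \<inter> {u..v})" for u v
  proof -
    have "S \<inter> {u..v} \<subseteq> t ` {j. t j \<le> v} \<union> {k \<in> \<int>. u \<le> k \<and> k \<le> v}"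
      by (auto simp: S_def)
    then show ?thesis
      by (rule finite_subset) (simp add: finite_impulses[OF assms(10)] finite_int_segment)
  qed
  have factor: "1 - \<beta> j \<ge> 0" if "j \<ge> 1" for j using assms(11)[OF that] by simp
  have B: "B s \<ge> 0" if "s \<ge> 0" for s
    unfolding B_def using assms(5)[OF that] factor
    by (intro mult_nonneg_nonneg prod_nonneg) auto
  have C: "C n s \<ge> 0" if "s \<ge> 0" for n s
    unfolding C_def using assms(7)[OF that] factor
    by (intro mult_nonneg_nonneg prod_nonneg) auto
  have "\<exists>k>1 / exp 1. (\<forall>\<^sub>F r in at_top. integral {r - l..r} B > k) \<or>
     (\<forall>\<^sub>F n in sequentially. integral {real n + 1 - l..real n + 1} (C n) > k)"
    using assms(13) unfolding B_def[symmetric] C_def[symmetric]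
    by (rule disjE) (erule less_Liminf_real_dense, blast)+
  then obtain k where k: "k > 1 / exp 1" and large:
    "(\<forall>\<^sub>F r in at_top. integral {r - l..r} B > k) \<or>
     (\<forall>\<^sub>F n in sequentially. integral {real n + 1 - l..real n + 1} (C n) > k)"
    by blast
  define y where "y = transformed a t \<beta> x"
  \<comment> \<open>The equation is linear, so the factor \<sigma>, used with 1 and -1, covers
    eventually positive and eventually negative solutions at once.\<close>
  have no_sign: False if \<sigma>: "\<forall>\<^sub>F s in at_top. \<sigma> * x s > 0" for \<sigma> :: real
  proof -
    obtain T0 where T0: "\<And>s. s \<ge> T0 \<Longrightarrow> \<sigma> * x s > 0"
      using \<sigma> by (auto simp: eventually_at_top_linorder)
    \<comment> \<open>Lying strictly beyond \<open>t 0\<close> makes continuity two-sided on the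
      whole half-line.\<close>
    define T where "T = max T0 (t 0 + 1)"
    have T: "T \<ge> T0" "T > t 0" "T \<ge> 0" using assms(1) by (auto simp: T_def)
    show False
    proof (rule no_positive_delay_solution[where y = "\<lambda>s. \<sigma> * y s" and B = B and C = C
          and S = S and T = T and k = k and \<tau> = \<tau> and l = l])
      show "B r \<ge> 0" "C n r \<ge> 0" if "r \<ge> T" for n r using that T(3) B C by simp_all
      show "continuous_on {T..} (\<lambda>s. \<sigma> * y s)"
        unfolding y_def
      proof (intro continuous_on_mult continuous_on_const continuous_at_imp_continuous_on ballI)
        show "isCont (transformed a t \<beta> x) s" if "s \<in> {T..}" for s
          using isCont_transformed[OF sol assms(1,9,10,2,3)] that T(2) by simp
      qed
      show "\<sigma> * y s > 0" if "s \<ge> T" for s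
        using T0[of s] T that impulse_weight_pos[of \<beta> t s, OF assms(11)]
        by (simp add: y_def transformed_def mult.assoc[symmetric])
      show "((\<lambda>s. \<sigma> * y s) has_real_derivative
          - (B r * (\<sigma> * y (r - \<tau>)) + C (nat \<lfloor>r\<rfloor>) r * (\<sigma> * y (real (nat \<lfloor>r\<rfloor>) - 1)))) (at r)"
        if r: "r \<ge> T + \<tau> + 1" "r \<notin> S" for r
      proof -
        have "(y has_real_derivative
          - (B r * y (r - \<tau>) + C (nat \<lfloor>r\<rfloor>) r * y (real (nat \<lfloor>r\<rfloor>) - 1))) (at r)"
          unfolding y_def B_def C_def
          by (rule transformed_deriv[OF sol assms(1,9,10,2,3) _ _ _ _ _ refl])
             (use assms(1,2) r T in \<open>auto simp: S_def\<close>)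
        from DERIV_cmult[OF this, of \<sigma>] show ?thesis by (simp add: algebra_simps)
      qed
    qed (fact assms(2,12) T(3) fin k large)+
  qed
  show "oscillatory x"
    using no_sign[of 1] no_sign[of "-1"] by (auto simp: oscillatory_def)
qed

end
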